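(* Let $t$ be a positive integer and let $C_n$ be the cycle on $n$ vertices ($n\ge 3$). Then $$c\chi_2^1(C_n)=\begin{cases}4,& \text{if } n>3,\\ 5,&\text{if } n=3,\end{cases}\qquad\text{and}\qquad c\chi_2^t(C_n)=\begin{cases}2,&\text{if } t\ge 2\text{ and } n \text{ is even},\\ 3,&\text{if } t\ge 2\text{ and } n\text{ is odd}.\end{cases}$$
   Context: Graphs are finite, undirected and simple. For a positive integer $k$ and $i,j\in\{0,1,\dots,k-1\}$, the circular distance is $|i-j|_k=\min\{|i-j|,\,k-|i-j|\}$. For a nonnegative integer $t$, a $(\frac{k}{2},t)^*$-coloring of a graph $G$ is a mapping $f:V(G)\to\{0,1,\dots,k-1\}$ such that adjacent vertices receive different integers and, for each vertex $u$, the number of neighbors $v$ of $u$ with $|f(u)-f(v)|_k=1$ is at most $t$. $G$ is $(\frac{k}{2},t)^*$-colorable if it has such a coloring. (The symbol $\frac{k}{2}$ is formal notation recording the pair $(k,2)$, not a reduced fraction.) The $t$-relaxed 2-distant circular chromatic number $c\chi_2^t(G)$ is the minimum positive integer $k$ such that $G$ is $(\frac{k}{2},t)^*$-colorable. *)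

theory Defs
  imports Graph_Theory.Pair_Digraph
begin

text \<open>
  A finite, undirected, simple graph is an instance of the locale \<^locale>\<open>pair_graph\<close>: a finite
  loopless digraph whose arc set is a symmetric relation on the vertices, an undirected edge
  \<open>uv\<close> being the two arcs \<open>(u, v)\<close> and \<open>(v, u)\<close>.  The definitions below are meant for such graphs.
\<close>

definition circ_dist :: "nat \<Rightarrow> nat \<Rightarrow> nat \<Rightarrow> int" where
  "circ_dist k i j = min \<bar>int i - int j\<bar> (int k - \<bar>int i - int j\<bar>)"

text \<open>
  \<open>relaxed_coloring G k t f\<close>: \<open>f\<close> is a \<open>(k/2, t)\<^sup>*\<close>-coloring of \<open>G\<close>.  The formal symbol \<open>k/2\<close>
  records the pair \<open>(k, 2)\<close>; only \<open>k\<close> is a parameter.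
\<close>

definition relaxed_coloring :: "'a pair_pre_digraph \<Rightarrow> nat \<Rightarrow> nat \<Rightarrow> ('a \<Rightarrow> nat) \<Rightarrow> bool" where
  "relaxed_coloring G k t f \<longleftrightarrow>
     (\<forall>u \<in> pverts G. f u \<in> {0..<k}) \<and>
     (\<forall>(u, v) \<in> parcs G. f u \<noteq> f v) \<and>
     (\<forall>u \<in> pverts G. card {v. (u, v) \<in> parcs G \<and> circ_dist k (f u) (f v) = 1} \<le> t)"

definition relaxed_colorable :: "'a pair_pre_digraph \<Rightarrow> nat \<Rightarrow> nat \<Rightarrow> bool" where
  "relaxed_colorable G k t \<longleftrightarrow> (\<exists>f. relaxed_coloring G k t f)"

definition circ_chromatic :: "nat \<Rightarrow> 'a pair_pre_digraph \<Rightarrow> nat" where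
  "circ_chromatic t G = (LEAST k. 0 < k \<and> relaxed_colorable G k t)"

definition cycle_graph :: "nat \<Rightarrow> nat pair_pre_digraph" where
  "cycle_graph n =
     \<lparr>pverts = {0..<n},
      parcs = {(i, j). i < n \<and> j < n \<and> (j = (i + 1) mod n \<or> i = (j + 1) mod n)}\<rparr>"

lemma cycle_graph_pair_graph:
  assumes "n \<ge> 3"
  shows "pair_graph (cycle_graph n)"
proof
  have "finite ({0..<n} \<times> {0..<n})" by simp
  moreover have "parcs (cycle_graph n) \<subseteq> {0..<n} \<times> {0..<n}"
    by (auto simp: cycle_graph_def)
  ultimately show "finite (parcs (cycle_graph n))"
    by (rule rev_finite_subset)
  show "fst e \<noteq> snd e" if "e \<in> parcs (cycle_graph n)" for e
    using that assms by (auto simp: cycle_graph_def mod_Suc split: if_splits)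
qed (auto simp: cycle_graph_def symmetric_def sym_def)

text \<open>The minimum in \<^const>\<open>circ_chromatic\<close> is attained: give all vertices distinct even colors.\<close>

lemma relaxed_colorable_exists:
  assumes "pair_graph G"
  shows "\<exists>k>0. relaxed_colorable G k t"
proof -
  interpret pair_graph G by fact
  obtain h :: "'a \<Rightarrow> nat" and m where h: "h ` pverts G = {i. i < m}" "inj_on h (pverts G)"
    using finite_imp_inj_to_nat_seg[OF pair_finite_verts] by metis
  have lt: "h u < m" if "u \<in> pverts G" for u using h(1) that by auto
  have ne: "h u \<noteq> h v" if "(u, v) \<in> parcs G" for u v
    using that h(2) pair_no_loops[OF that] in_arcsD1[OF that] in_arcsD2[OF that]
    by (auto dest: inj_onD)
  have "circ_dist (2 * m + 2) (2 * a) (2 * b) \<noteq> 1" for a b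
    unfolding circ_dist_def by (simp add: min_def abs_if) presburger
  then have "relaxed_coloring G (2 * m + 2) t (\<lambda>u. 2 * h u)"
    using lt ne by (fastforce simp: relaxed_coloring_def)
  then show ?thesis
    unfolding relaxed_colorable_def by (intro exI[of _ "2 * m + 2"]) auto
qed

lemma circ_chromatic_attained:
  assumes "pair_graph G"
  shows "0 < circ_chromatic t G \<and> relaxed_colorable G (circ_chromatic t G) t"
  using relaxed_colorable_exists[OF assms, of t] unfolding circ_chromatic_def by (rule LeastI_ex)

end

theory Submission
  imports Defs
begin

text \<open>Every vertex of a cycle has exactly two neighbors. For \<open>t \<ge> 2\<close> the
  defect bound is therefore vacuous, and the value is the ordinary chromatic number: 2 for even
  cycles, 3 for odd ones. For \<open>t = 1\<close> no vertex may have both neighbors at circular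
  distance 1. With at most three colors any two distinct colors are at distance 1, so at least four
  are needed (\<open>cycle_not_colorable_one_three\<close>). Four suffice once \<open>n > 3\<close>
  (\<open>cycle_coloring_one_four\<close>), but on the triangle three distinct residues modulo 4
  always violate the bound (\<open>triangle_not_colorable_one_four\<close>), while 0, 2, 4 modulo 5
  work. The reduction to conditions on successor and predecessor is
  \<open>relaxed_coloring_cycle_iff\<close>.\<close>

definition cyc_succ :: "nat \<Rightarrow> nat \<Rightarrow> nat" where
  "cyc_succ n i = (if Suc i = n then 0 else Suc i)"

definition cyc_pred :: "nat \<Rightarrow> nat \<Rightarrow> nat" where
  "cyc_pred n i = (if i = 0 then n - 1 else i - 1)"

lemma cycle_graph_arc_iff:
  assumes "n \<ge> 3"
  shows "(u, v) \<in> parcs (cycle_graph n) \<longleftrightarrow> u < n \<and> (v = cyc_succ n u \<or> v = cyc_pred n u)"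
  using assms by (auto simp: cycle_graph_def cyc_succ_def cyc_pred_def mod_Suc split: if_splits)

text \<open>For \<open>n \<ge> 3\<close> the two neighbors of a vertex are distinct, so the
  cardinality in the defect condition is a sum of two indicators.\<close>

lemma relaxed_coloring_cycle_iff:
  assumes "n \<ge> 3"
  shows "relaxed_coloring (cycle_graph n) k t f \<longleftrightarrow>
    (\<forall>i<n. f i < k \<and> f i \<noteq> f (cyc_succ n i) \<and>
       of_bool (circ_dist k (f i) (f (cyc_succ n i)) = 1) +
       of_bool (circ_dist k (f i) (f (cyc_pred n i)) = 1) \<le> t)"
proof -
  have card_eq: "card {v. (u, v) \<in> parcs (cycle_graph n) \<and> circ_dist k (f u) (f v) = 1} =
      of_bool (circ_dist k (f u) (f (cyc_succ n u)) = 1) +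
      of_bool (circ_dist k (f u) (f (cyc_pred n u)) = 1)" if "u < n" for u
  proof -
    have "{v. (u, v) \<in> parcs (cycle_graph n) \<and> circ_dist k (f u) (f v) = 1} =
        (if circ_dist k (f u) (f (cyc_succ n u)) = 1 then {cyc_succ n u} else {}) \<union>
        (if circ_dist k (f u) (f (cyc_pred n u)) = 1 then {cyc_pred n u} else {})"
      using that by (auto simp: cycle_graph_arc_iff[OF assms])
    moreover have "cyc_succ n u \<noteq> cyc_pred n u"
      using assms by (auto simp: cyc_succ_def cyc_pred_def)
    ultimately show ?thesis by auto
  qed
  have proper: "(\<forall>(u, v) \<in> parcs (cycle_graph n). f u \<noteq> f v) \<longleftrightarrow>
      (\<forall>u<n. f u \<noteq> f (cyc_succ n u))"
  proof -
    \<comment> \<open>Properness need only be tested on forward edges: the edge from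
      \<open>u\<close> to its predecessor is the forward edge of that predecessor.\<close>
    have "cyc_pred n u < n" "cyc_succ n (cyc_pred n u) = u" if "u < n" for u
      using that assms by (auto simp: cyc_succ_def cyc_pred_def)
    then show ?thesis
      unfolding case_prod_unfold Ball_def split_paired_All fst_conv snd_conv
        cycle_graph_arc_iff[OF assms] by metis
  qed
  have "pverts (cycle_graph n) = {0..<n}"
    by (simp add: cycle_graph_def)
  then show ?thesis
    unfolding relaxed_coloring_def proper by (auto simp: card_eq)
qed

lemma relaxed_coloring_cycle_iff_proper:
  assumes "n \<ge> 3" "t \<ge> 2"
  shows "relaxed_coloring (cycle_graph n) k t f \<longleftrightarrow>
    (\<forall>i<n. f i < k \<and> f i \<noteq> f (cyc_succ n i))"
  using assms by (auto simp: relaxed_coloring_cycle_iff of_bool_def)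

lemma circ_chromatic_eqI:
  assumes "0 < k" "relaxed_coloring G k t f"
    and "\<And>m. 0 < m \<Longrightarrow> m < k \<Longrightarrow> \<not> relaxed_colorable G m t"
  shows "circ_chromatic t G = k"
  unfolding circ_chromatic_def
  using assms by (intro Least_equality) (auto simp: relaxed_colorable_def not_less[symmetric])

lemma circ_dist_le_three:
  assumes "k \<le> 3" "a < k" "b < k" "a \<noteq> b"
  shows "circ_dist k a b = 1"
  using assms by (auto simp: circ_dist_def min_def abs_if)

text \<open>By \<open>circ_dist_le_three\<close> every edge of a proper coloring counts as a defect,
  so each vertex has two. Vertex 1 serves as witness because its neighbors 0 and 2 involve no
  wrap-around, even for \<open>n = 3\<close>.\<close>

lemma cycle_not_colorable_one_three:
  assumes "n \<ge> 3" "k \<le> 3"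
  shows "\<not> relaxed_colorable (cycle_graph n) k 1"
proof
  assume "relaxed_colorable (cycle_graph n) k 1"
  then obtain f where f: "\<And>i. i < n \<Longrightarrow> f i < k" "\<And>i. i < n \<Longrightarrow> f i \<noteq> f (cyc_succ n i)"
    "\<And>i. i < n \<Longrightarrow> of_bool (circ_dist k (f i) (f (cyc_succ n i)) = 1) +
       of_bool (circ_dist k (f i) (f (cyc_pred n i)) = 1) \<le> (1::nat)"
    using assms by (auto simp: relaxed_colorable_def relaxed_coloring_cycle_iff)
  have "cyc_succ n 0 = 1" "cyc_succ n 1 = 2" "cyc_pred n 1 = 0"
    using assms by (auto simp: cyc_succ_def cyc_pred_def)
  moreover have "circ_dist k (f 1) (f 2) = 1" "circ_dist k (f 1) (f 0) = 1"
    using f(1)[of 0] f(1)[of 1] f(1)[of 2] f(2)[of 0] f(2)[of 1] assms calculation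
    by (auto intro!: circ_dist_le_three)
  ultimately show False using f(3)[of 1] assms by simp
qed

text \<open>Three distinct residues modulo 4 omit exactly one, and the residue opposite the omitted
  one is at distance 1 from both others. The proof checks all color triples.\<close>

lemma triangle_not_colorable_one_four: "\<not> relaxed_colorable (cycle_graph 3) 4 1"
proof
  assume "relaxed_colorable (cycle_graph 3) 4 1"
  then obtain f where *: "f i < 4 \<and> f i \<noteq> f (cyc_succ 3 i) \<and>
      of_bool (circ_dist 4 (f i) (f (cyc_succ 3 i)) = 1) +
      of_bool (circ_dist 4 (f i) (f (cyc_pred 3 i)) = 1) \<le> (1::nat)" if "i < 3" for i
    by (auto simp: relaxed_colorable_def relaxed_coloring_cycle_iff)
  have neighbors: "cyc_succ 3 0 = 1" "cyc_succ 3 1 = 2" "cyc_succ 3 2 = 0"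
    "cyc_pred 3 0 = 2" "cyc_pred 3 1 = 0" "cyc_pred 3 2 = 1"
    by (simp_all add: cyc_succ_def cyc_pred_def)
  have f: "f 0 < 4" "f 1 < 4" "f 2 < 4" "f 0 \<noteq> f 1" "f 1 \<noteq> f 2" "f 2 \<noteq> f 0"
    "\<not> (circ_dist 4 (f 0) (f 1) = 1 \<and> circ_dist 4 (f 0) (f 2) = 1)"
    "\<not> (circ_dist 4 (f 1) (f 2) = 1 \<and> circ_dist 4 (f 1) (f 0) = 1)"
    "\<not> (circ_dist 4 (f 2) (f 0) = 1 \<and> circ_dist 4 (f 2) (f 1) = 1)"
    using *[of 0] *[of 1] *[of 2] unfolding neighbors by auto
  have cases: "x = 0 \<or> x = 1 \<or> x = 2 \<or> x = 3" if "x < 4" for x :: nat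
    using that by auto
  show False
    using cases[OF f(1)] cases[OF f(2)] cases[OF f(3)] f(4-9)
    by (elim disjE) (simp_all add: circ_dist_def)
qed

text \<open>Two colors must alternate along the path from 0 to \<open>n - 1\<close>; for odd
  \<open>n\<close> its ends then share a color, contradicting the closing edge.\<close>

lemma odd_cycle_not_colorable_two:
  assumes "n \<ge> 3" "odd n" "k \<le> 2" "t \<ge> 2"
  shows "\<not> relaxed_colorable (cycle_graph n) k t"
proof
  assume "relaxed_colorable (cycle_graph n) k t"
  then obtain f where f: "\<And>i. i < n \<Longrightarrow> f i < k" "\<And>i. i < n \<Longrightarrow> f i \<noteq> f (cyc_succ n i)"
    using assms by (auto simp: relaxed_colorable_def relaxed_coloring_cycle_iff_proper)
  have "f i = (f 0 + i) mod 2" if "i < n" for i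
    using that
  proof (induction i)
    case 0
    then show ?case using f(1)[of 0] assms by simp
  next
    case (Suc i)
    have "f (Suc i) < 2" "f i < 2" "f i \<noteq> f (Suc i)"
      using f(1)[of i] f(1)[of "Suc i"] f(2)[of i] Suc.prems assms(3)
      by (simp_all add: cyc_succ_def)
    moreover have "f i = (f 0 + i) mod 2"
      using Suc by simp
    ultimately show ?case by presburger
  qed
  from this[of "n - 1"] have "f (n - 1) = f 0 mod 2"
    using assms by (auto elim!: oddE)
  then show False
    using f(1)[of 0] f(2)[of "n - 1"] assms by (simp add: cyc_succ_def)
qed

text \<open>Colors 0 and 2 are at distance 2, so alternating them gives an even cycle no defects at
  all. An odd cycle is given exactly two edges at distance 1, namely 0-1 and 2-3; they share no
  vertex, so each vertex meets at most one.\<close>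

lemma cycle_coloring_one_four:
  assumes "n > 3"
  shows "\<exists>f. relaxed_coloring (cycle_graph n) 4 1 f"
proof (cases "even n")
  case True
  have "relaxed_coloring (cycle_graph n) 4 1 (\<lambda>i. if even i then 0 else 2)"
    using assms True
    by (auto simp: relaxed_coloring_cycle_iff cyc_succ_def cyc_pred_def circ_dist_def)
  then show ?thesis by blast
next
  case False
  \<comment> \<open>An odd cycle is colored along a closed walk modulo 4 with steps 1, 2, 1 and then only 2.\<close>
  define f :: "nat \<Rightarrow> nat"
    where "f i = (if i = 1 then 1 else if i = 2 then 3 else if i = 0 \<or> odd i then 0 else 2)" for i
  have dist: "circ_dist 4 0 2 = 2" "circ_dist 4 2 0 = 2" "circ_dist 4 1 3 = 2"
    "circ_dist 4 3 1 = 2"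
    by (simp_all add: circ_dist_def)
  \<comment> \<open>Hence the last vertex \<open>n - 1\<close> is even and at least 4, so it has
    color 2 and the closing edge to color 0 is at distance 2.\<close>
  have n: "n \<ge> 5" using assms False by presburger
  have "f i < 4 \<and> f i \<noteq> f (cyc_succ n i) \<and>
      of_bool (circ_dist 4 (f i) (f (cyc_succ n i)) = 1) +
      of_bool (circ_dist 4 (f i) (f (cyc_pred n i)) = 1) \<le> (1::nat)" if "i < n" for i
  proof -
    \<comment> \<open>The irregular start and the wrap-around vertex are separated from the range
      where \<open>i\<close> and both its neighbors follow the alternation of 0 and 2.\<close>
    have "i = 0 \<or> i = 1 \<or> i = 2 \<or> i = 3 \<or> i = n - 1 \<and> i \<ge> 4 \<or> 4 \<le> i \<and> Suc i < n"
      using that by arith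
    then consider "i = 0" | "i = 1" | "i = 2" | "i = 3" | "i = n - 1" "i \<ge> 4" | "4 \<le> i" "Suc i < n"
      by blast
    then show ?thesis
    proof cases
      case 6
      then have "f i = (if odd i then 0 else 2)" "f (cyc_succ n i) = (if odd i then 2 else 0)"
        "f (cyc_pred n i) = (if odd i then 2 else 0)"
        by (auto simp: f_def cyc_succ_def cyc_pred_def)
      then show ?thesis by (simp add: dist)
    qed (use False n dist in \<open>auto simp: f_def cyc_succ_def cyc_pred_def\<close>)
  qed
  then have "relaxed_coloring (cycle_graph n) 4 1 f"
    using n by (simp add: relaxed_coloring_cycle_iff)
  then show ?thesis by blast
qed

text \<open>Among the colors 0, 2, 4 only the pair 4, 0 is at distance 1 modulo 5.\<close>

lemma triangle_coloring_one_five: "relaxed_coloring (cycle_graph 3) 5 1 (\<lambda>i. 2 * i)"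
  by (auto simp: relaxed_coloring_cycle_iff cyc_succ_def cyc_pred_def circ_dist_def)

lemma even_cycle_coloring_two:
  assumes "n \<ge> 3" "even n" "t \<ge> 2"
  shows "relaxed_coloring (cycle_graph n) 2 t (\<lambda>i. i mod 2)"
  using assms
  by (auto simp: relaxed_coloring_cycle_iff_proper cyc_succ_def mod_Suc even_iff_mod_2_eq_zero
        split: if_splits)

text \<open>The remaining vertices alternate 0 and 1; a private color for the last vertex makes the
  closing edge proper whatever the parity of \<open>n\<close>.\<close>

lemma cycle_coloring_three:
  assumes "n \<ge> 3" "t \<ge> 2"
  shows "relaxed_coloring (cycle_graph n) 3 t (\<lambda>i. if Suc i = n then 2 else i mod 2)"
  using assms
  by (auto simp: relaxed_coloring_cycle_iff_proper cyc_succ_def mod_Suc less_Suc_eq)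

theorem theorem2p2:
  fixes n t :: nat
  assumes "n \<ge> 3" and "t \<ge> 1"
  shows "circ_chromatic 1 (cycle_graph n) = (if n > 3 then 4 else 5) \<and>
         (t \<ge> 2 \<longrightarrow> circ_chromatic t (cycle_graph n) = (if even n then 2 else 3))"
proof (intro conjI impI)
  show "circ_chromatic 1 (cycle_graph n) = (if n > 3 then 4 else 5)"
  proof (cases "n > 3")
    case True
    then obtain f where "relaxed_coloring (cycle_graph n) 4 1 f"
      using cycle_coloring_one_four by blast
    then have "circ_chromatic 1 (cycle_graph n) = 4"
      using assms cycle_not_colorable_one_three by (intro circ_chromatic_eqI) auto
    then show ?thesis using True by simp
  next
    case False
    then have n: "n = 3" using assms by simp
    have "\<not> relaxed_colorable (cycle_graph 3) m 1" if "m < 5" for m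
      using that cycle_not_colorable_one_three[of 3 m] triangle_not_colorable_one_four
      by (cases "m = 4") auto
    then have "circ_chromatic 1 (cycle_graph 3) = 5"
      using triangle_coloring_one_five by (intro circ_chromatic_eqI) auto
    then show ?thesis using n by simp
  qed
next
  assume t: "t \<ge> 2"
  show "circ_chromatic t (cycle_graph n) = (if even n then 2 else 3)"
  proof (cases "even n")
    case True
    have "\<not> relaxed_colorable (cycle_graph n) m t" if "m < 2" for m
    proof -
      \<comment> \<open>Fewer than two colors already fail on the single edge 0-1.\<close>
      have "\<not> (f 0 < m \<and> f 1 < m \<and> f 0 \<noteq> f 1)" for f :: "nat \<Rightarrow> nat"
        using that by auto
      moreover have "cyc_succ n 0 = 1" "0 < n" "1 < n"
        using assms by (auto simp: cyc_succ_def)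
      ultimately show ?thesis
        using assms t by (metis relaxed_colorable_def relaxed_coloring_cycle_iff_proper)
    qed
    then have "circ_chromatic t (cycle_graph n) = 2"
      using even_cycle_coloring_two assms t True by (intro circ_chromatic_eqI) auto
    then show ?thesis using True by simp
  next
    case False
    then have "circ_chromatic t (cycle_graph n) = 3"
      using cycle_coloring_three odd_cycle_not_colorable_two assms t
      by (intro circ_chromatic_eqI) auto
    then show ?thesis using False by simp
  qed
qed

end
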